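(* Let $p\ge 3$, $n\ge 0$ be integers and $r=\min\{n,p\}$. For all integers $1\le\nu\le\mu\le r$, \[ O_p^n(\nu\mid\mu)=\binom{n}{\nu}\begin{Bmatrix} n-\nu\\ \mu-\nu\end{Bmatrix}_{\ge 2}\,p^{\underline{\mu}}. \]
   Context: Consider the Tower of Hanoi with $p$ labeled pegs and $n$ discs of distinct sizes; a (regular) state is any assignment of each disc to a peg (discs on each peg being stacked in decreasing size). A peg is occupied if it holds at least one disc and a singleton if it holds exactly one disc. $O_p^n(\nu\mid\mu)$ is the number of states with exactly $\mu$ occupied pegs, exactly $\nu$ of which are singletons. $p^{\underline{\mu}}=p(p-1)\cdots(p-\mu+1)$ is the falling factorial, and $\begin{Bmatrix} m\\ k\end{Bmatrix}_{\ge 2}$ is the 2-associated Stirling number of the second kind, i.e. the number of partitions of an $m$-element set into $k$ blocks each of size at least $2$. *)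

theory Defs
  imports Complex_Main "HOL-Library.FuncSet" "HOL-Library.Disjoint_Sets"
begin

text \<open>
  Pegs are labelled by \<open>{..<p}\<close> and discs by \<open>{..<n}\<close>. Since the discs on a peg are
  always stacked in decreasing size, a regular state is determined by the map sending each disc
  to its peg. Extensional functions make each state a single element of the set.
\<close>

definition hanoi_states :: "nat \<Rightarrow> nat \<Rightarrow> (nat \<Rightarrow> nat) set" where
  "hanoi_states p n = {..<n} \<rightarrow>\<^sub>E {..<p}"

definition discs_on :: "nat \<Rightarrow> (nat \<Rightarrow> nat) \<Rightarrow> nat \<Rightarrow> nat set" where
  "discs_on n s i = {d \<in> {..<n}. s d = i}"

definition occupied_pegs :: "nat \<Rightarrow> nat \<Rightarrow> (nat \<Rightarrow> nat) \<Rightarrow> nat set" where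
  "occupied_pegs p n s = {i \<in> {..<p}. card (discs_on n s i) \<ge> 1}"

definition singleton_pegs :: "nat \<Rightarrow> nat \<Rightarrow> (nat \<Rightarrow> nat) \<Rightarrow> nat set" where
  "singleton_pegs p n s = {i \<in> {..<p}. card (discs_on n s i) = 1}"

text \<open>\<open>hanoi_O p n \<nu> \<mu>\<close> is \<open>O\<^sub>p\<^sup>n(\<nu> | \<mu>)\<close>.\<close>

definition hanoi_O :: "nat \<Rightarrow> nat \<Rightarrow> nat \<Rightarrow> nat \<Rightarrow> nat" where
  "hanoi_O p n \<nu> \<mu> = card {s \<in> hanoi_states p n.
     card (occupied_pegs p n s) = \<mu> \<and> card (singleton_pegs p n s) = \<nu>}"

definition assoc2_Stirling :: "nat \<Rightarrow> nat \<Rightarrow> nat" where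
  "assoc2_Stirling m k =
     card {P. partition_on {..<m} P \<and> card P = k \<and> (\<forall>B\<in>P. card B \<ge> 2)}"

text \<open>
  Truncated subtraction is harmless here: if \<open>m > p\<close>, the factor for \<open>i = p\<close> is zero anyway.
\<close>

definition falling_factorial :: "nat \<Rightarrow> nat \<Rightarrow> nat" where
  "falling_factorial p m = (\<Prod>i<m. p - i)"

end

theory Submission
  imports Defs
begin

text \<open>
  A state with exactly \<open>\<mu>\<close> occupied pegs is a partition of the discs into \<open>\<mu>\<close> blocks
  together with an injection of the blocks into the pegs, which gives the factor
  \<open>falling_factorial p \<mu>\<close>. The pegs holding a single disc correspond to the singleton blocks,
  and a partition with exactly \<open>\<nu>\<close> singleton blocks amounts to a choice of \<open>\<nu>\<close> discs and a
  partition of the remaining ones into \<open>\<mu> - \<nu>\<close> blocks of size at least two.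
\<close>

section \<open>Fibres of a map as a partition of its domain\<close>

definition fibre_partition :: "'a set \<Rightarrow> ('a \<Rightarrow> 'b) \<Rightarrow> 'a set set" where
  "fibre_partition A s = (\<lambda>i. {d \<in> A. s d = i}) ` s ` A"

definition block_of :: "'a set set \<Rightarrow> 'a \<Rightarrow> 'a set" where
  "block_of P d = (THE B. B \<in> P \<and> d \<in> B)"

definition singleton_blocks :: "'a set set \<Rightarrow> 'a set set" where
  "singleton_blocks P = {B \<in> P. card B = 1}"

lemma block_of_eq:
  assumes "partition_on A P" "B \<in> P" "d \<in> B"
  shows "block_of P d = B"
  unfolding block_of_def
  using assms by (intro the_equality) (auto simp: partition_on_def disjoint_def)

lemma block_of_mem:
  assumes "partition_on A P" "d \<in> A"
  shows "block_of P d \<in> P" "d \<in> block_of P d"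
proof -
  obtain B where "B \<in> P" "d \<in> B"
    using assms by (auto simp: partition_on_def)
  with assms(1) show "block_of P d \<in> P" "d \<in> block_of P d"
    using block_of_eq by metis+
qed

lemma partition_on_fibre_partition: "partition_on A (fibre_partition A s)"
  by (auto simp: partition_on_def fibre_partition_def disjoint_def)

text \<open>A fibre over a point of the image is nonempty, and any of its elements determines the
  point.\<close>

lemma inj_on_fibres: "inj_on (\<lambda>i. {d \<in> A. s d = i}) (s ` A)"
  by (auto simp: inj_on_def)

lemma card_fibre_partition: "card (fibre_partition A s) = card (s ` A)"
  unfolding fibre_partition_def by (rule card_image[OF inj_on_fibres])

lemma card_singleton_blocks_fibre_partition:
  "card (singleton_blocks (fibre_partition A s)) = card {i \<in> s ` A. card {d \<in> A. s d = i} = 1}"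
proof -
  have "singleton_blocks (fibre_partition A s)
      = (\<lambda>i. {d \<in> A. s d = i}) ` {i \<in> s ` A. card {d \<in> A. s d = i} = 1}"
    by (auto simp: singleton_blocks_def fibre_partition_def)
  moreover have "inj_on (\<lambda>i. {d \<in> A. s d = i}) {i \<in> s ` A. card {d \<in> A. s d = i} = 1}"
    by (rule inj_on_subset[OF inj_on_fibres]) auto
  ultimately show ?thesis
    by (simp add: card_image)
qed

section \<open>Maps with a prescribed fibre partition\<close>

text \<open>Blocks are nonempty, so each value \<open>f B\<close> is attained; injectivity of
  \<open>f\<close> prevents two blocks from merging into one fibre.\<close>

lemma fibre_partition_lift:
  assumes P: "partition_on A P" and f: "inj_on f P"
  shows "fibre_partition A (\<lambda>d\<in>A. f (block_of P d)) = P"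
proof -
  let ?s = "\<lambda>d\<in>A. f (block_of P d)"
  have image: "?s ` A = f ` P"
  proof (intro equalityI subsetI)
    fix i assume "i \<in> ?s ` A"
    then show "i \<in> f ` P" using block_of_mem[OF P] by auto
  next
    fix i assume "i \<in> f ` P"
    then obtain B where B: "B \<in> P" "i = f B" by blast
    then obtain d where d: "d \<in> B" using partition_onD3[OF P] by (metis all_not_in_conv)
    have "d \<in> A" using P B(1) d by (auto simp: partition_on_def)
    moreover have "i = ?s d"
      using \<open>d \<in> A\<close> block_of_eq[OF P B(1) d] B(2) by simp
    ultimately show "i \<in> ?s ` A" by blast
  qed
  have fibre: "{d \<in> A. ?s d = f B} = B" if B: "B \<in> P" for B
  proof (intro equalityI subsetI)
    fix d assume "d \<in> {d \<in> A. ?s d = f B}"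
    then have "d \<in> A" "f (block_of P d) = f B" by auto
    then show "d \<in> B"
      using block_of_mem[OF P] B f by (metis inj_onD)
  next
    fix d assume "d \<in> B"
    then show "d \<in> {d \<in> A. ?s d = f B}"
      using block_of_eq[OF P B] P B by (auto simp: partition_on_def)
  qed
  show ?thesis
    unfolding fibre_partition_def image image_image using fibre by simp
qed

text \<open>A map with fibre partition \<open>P\<close> is constant on each block and separates
  distinct blocks, so it is the same as an injective labelling of the blocks. The inverse reads off
  the label of a block at a chosen element, which exists because blocks are nonempty.\<close>

lemma bij_betw_lift:
  assumes P: "partition_on A P"
  shows "bij_betw (\<lambda>f. \<lambda>d\<in>A. f (block_of P d))
    {f \<in> P \<rightarrow>\<^sub>E T. inj_on f P} {s \<in> A \<rightarrow>\<^sub>E T. fibre_partition A s = P}"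
proof (rule bij_betw_byWitness[where f' = "\<lambda>s. \<lambda>B\<in>P. s (SOME d. d \<in> B)"])
  have some: "(SOME d. d \<in> B) \<in> B" if "B \<in> P" for B
    using P that by (metis partition_on_def some_in_eq)
  have sub: "B \<subseteq> A" if "B \<in> P" for B
    using P that by (auto simp: partition_on_def)
  have const: "s d = s e"
    if "fibre_partition A s = P" "B \<in> P" "d \<in> B" "e \<in> B" for s :: "'a \<Rightarrow> 'b" and B d e
    using that by (auto simp: fibre_partition_def)
  show "\<forall>f\<in>{f \<in> P \<rightarrow>\<^sub>E T. inj_on f P}.
      (\<lambda>B\<in>P. (\<lambda>d\<in>A. f (block_of P d)) (SOME d. d \<in> B)) = f"
  proof (intro ballI ext)
    fix f B assume "f \<in> {f \<in> P \<rightarrow>\<^sub>E T. inj_on f P}"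
    then have f: "f \<in> P \<rightarrow>\<^sub>E T" by simp
    show "(\<lambda>B\<in>P. (\<lambda>d\<in>A. f (block_of P d)) (SOME d. d \<in> B)) B = f B"
    proof (cases "B \<in> P")
      case True
      then have "(SOME d. d \<in> B) \<in> A" "block_of P (SOME d. d \<in> B) = B"
        using some sub block_of_eq[OF P True] by blast+
      then show ?thesis using True by simp
    \<comment> \<open>Outside \<open>P\<close> both sides are \<open>undefined\<close>, since
      \<open>f\<close> is extensional.\<close>
    qed (simp add: PiE_arb[OF f])
  qed
  show "\<forall>s\<in>{s \<in> A \<rightarrow>\<^sub>E T. fibre_partition A s = P}.
      (\<lambda>d\<in>A. (\<lambda>B\<in>P. s (SOME d. d \<in> B)) (block_of P d)) = s"
  proof (intro ballI ext)
    fix s d assume "s \<in> {s \<in> A \<rightarrow>\<^sub>E T. fibre_partition A s = P}"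
    then have s: "s \<in> A \<rightarrow>\<^sub>E T" "fibre_partition A s = P" by auto
    show "(\<lambda>d\<in>A. (\<lambda>B\<in>P. s (SOME d. d \<in> B)) (block_of P d)) d = s d"
    proof (cases "d \<in> A")
      case True
      then have "s (SOME e. e \<in> block_of P d) = s d"
        using const[OF s(2)] some block_of_mem[OF P True] by blast
      then show ?thesis using True block_of_mem[OF P True] by simp
    qed (simp add: PiE_arb[OF s(1)])
  qed
  show "(\<lambda>f. \<lambda>d\<in>A. f (block_of P d)) ` {f \<in> P \<rightarrow>\<^sub>E T. inj_on f P}
      \<subseteq> {s \<in> A \<rightarrow>\<^sub>E T. fibre_partition A s = P}"
    using block_of_mem(1)[OF P] fibre_partition_lift[OF P] by (auto intro!: PiE_I)
  show "(\<lambda>s. \<lambda>B\<in>P. s (SOME d. d \<in> B)) ` {s \<in> A \<rightarrow>\<^sub>E T. fibre_partition A s = P}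
      \<subseteq> {f \<in> P \<rightarrow>\<^sub>E T. inj_on f P}"
  proof (intro image_subsetI CollectI conjI)
    fix s assume s: "s \<in> {s \<in> A \<rightarrow>\<^sub>E T. fibre_partition A s = P}"
    show "(\<lambda>B\<in>P. s (SOME d. d \<in> B)) \<in> P \<rightarrow>\<^sub>E T"
      using s some sub by (intro restrict_PiE_iff[THEN iffD2]) blast
    show "inj_on (\<lambda>B\<in>P. s (SOME d. d \<in> B)) P"
    proof (rule inj_onI)
      fix B C assume BC: "B \<in> P" "C \<in> P"
        and "(\<lambda>B\<in>P. s (SOME d. d \<in> B)) B = (\<lambda>B\<in>P. s (SOME d. d \<in> B)) C"
      then have eq: "s (SOME d. d \<in> B) = s (SOME d. d \<in> C)" by simp
      \<comment> \<open>Both blocks are fibres of \<open>s\<close>; the chosen elements show that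
        they lie over the same point.\<close>
      from BC s obtain i j where "B = {d \<in> A. s d = i}" "C = {d \<in> A. s d = j}"
        by (auto simp: fibre_partition_def)
      with eq some[OF BC(1)] some[OF BC(2)] show "B = C" by auto
    qed
  qed
qed

text \<open>The library counts functions injective on a subset of their domain, with a power factor
  for the free values elsewhere. Taking the subset to be all of \<open>S\<close> makes that exponent
  0.\<close>

lemma card_inj_PiE:
  assumes "finite S"
  shows "card {f \<in> S \<rightarrow>\<^sub>E {..<p}. inj_on f S} = falling_factorial p (card S)"
  using card_inj_on_subset_funcset[OF assms, of "{..<p}" S]
  by (simp add: falling_factorial_def lessThan_atLeast0)

lemma finite_partitions:
  assumes "finite A"
  shows "finite {P. partition_on A P \<and> Q P}"
  by (rule finite_subset[of _ "Pow (Pow A)"]) (use assms in \<open>auto simp: partition_on_def\<close>)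

text \<open>Maps are sorted by their fibre partition. All classes have the same size because it
  depends only on the number of blocks, which \<open>Q\<close> fixes.\<close>

lemma card_states_by_partition:
  assumes A: "finite A" and Q: "\<And>P. Q P \<Longrightarrow> card P = \<mu>"
  shows "card {s \<in> A \<rightarrow>\<^sub>E {..<p}. Q (fibre_partition A s)}
    = card {P. partition_on A P \<and> Q P} * falling_factorial p \<mu>"
proof -
  let ?\<P> = "{P. partition_on A P \<and> Q P}"
  let ?F = "\<lambda>P. {s \<in> A \<rightarrow>\<^sub>E {..<p}. fibre_partition A s = P}"
  have "{s \<in> A \<rightarrow>\<^sub>E {..<p}. Q (fibre_partition A s)} = (\<Union>P\<in>?\<P>. ?F P)"
    using partition_on_fibre_partition by auto
  moreover have "card (\<Union>P\<in>?\<P>. ?F P) = (\<Sum>P\<in>?\<P>. card (?F P))"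
  proof (rule card_UN_disjoint)
    show "finite ?\<P>" using finite_partitions[OF A] .
    have "finite (A \<rightarrow>\<^sub>E {..<p})" using A by (simp add: finite_PiE)
    then show "\<forall>P\<in>?\<P>. finite (?F P)" by simp
  qed auto
  moreover have "card (?F P) = falling_factorial p \<mu>" if "P \<in> ?\<P>" for P
  proof -
    have "card (?F P) = card {f \<in> P \<rightarrow>\<^sub>E {..<p}. inj_on f P}"
      using that bij_betw_same_card[OF bij_betw_lift[of A P "{..<p}"]] by simp
    moreover have "finite P" using that A finite_elements by auto
    ultimately show ?thesis using card_inj_PiE that Q by auto
  qed
  ultimately show ?thesis by simp
qed

section \<open>Transport of partitions along bijections\<close>

lemma image_image_partition_id:
  assumes P: "partition_on A P" and uv: "\<And>x. x \<in> A \<Longrightarrow> u (v x) = x"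
  shows "(`) u ` (`) v ` P = P"
proof -
  have "u ` v ` B = B" if "B \<in> P" for B
  proof -
    have "u ` v ` B = id ` B"
      unfolding image_image
      by (rule image_cong) (use that uv partition_onD1[OF P] in auto)
    then show ?thesis by simp
  qed
  then show ?thesis by (simp add: image_image)
qed

text \<open>\<open>assoc2_Stirling\<close> is defined on an initial segment of the naturals, while
  the count is needed for the discs left after removing some. A bijection carries blocks to blocks
  of the same size.\<close>

lemma card_partitions_blocks_ge_2:
  fixes A :: "'a set"
  assumes "finite A"
  shows "card {P. partition_on A P \<and> card P = k \<and> (\<forall>B\<in>P. card B \<ge> 2)}
    = assoc2_Stirling (card A) k"
proof -
  let ?X = "\<lambda>A. {P. partition_on A P \<and> card P = k \<and> (\<forall>B\<in>P. card B \<ge> 2)}"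
  \<comment> \<open>Stated for any bijection, as it is applied both to \<open>h\<close> and to its
    inverse \<open>?g\<close>.\<close>
  have transport: "(`) h ` P \<in> {P. partition_on B P \<and> card P = k \<and> (\<forall>B\<in>P. card B \<ge> 2)}"
    if h: "bij_betw h A B" and P: "P \<in> ?X A" for h :: "'b \<Rightarrow> 'c" and A B P
  proof -
    have inj: "inj_on h A" and im: "h ` A = B" using h by (auto simp: bij_betw_def)
    have sub: "C \<subseteq> A" if "C \<in> P" for C using P that by (auto simp: partition_on_def)
    have part: "partition_on A P" using P by simp
    \<comment> \<open>\<open>partition_on_inj_image\<close> discards an empty block from the image
      family; here there is none to discard.\<close>
    have eq: "(`) h ` P - {{}} = (`) h ` P" using part by (auto simp: partition_on_def)
    have "partition_on B ((`) h ` P)"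
      using partition_on_inj_image[OF part inj] im eq by simp
    moreover have "card ((`) h ` P) = card P"
      using inj_on_image[of h P] inj part by (auto simp: partition_on_def intro!: card_image)
    moreover have "card (h ` C) = card C" if "C \<in> P" for C
      using inj sub[OF that] by (meson card_image inj_on_subset)
    ultimately show ?thesis using P by auto
  qed
  obtain h where h: "bij_betw h A {..<card A}"
    using ex_bij_betw_finite_nat[OF assms] lessThan_atLeast0 by metis
  let ?g = "inv_into A h"
  have g: "bij_betw ?g {..<card A} A" using h by (rule bij_betw_inv_into)
  have "bij_betw ((`) ((`) h)) (?X A) (?X {..<card A})"
  proof (rule bij_betw_byWitness[where f' = "(`) ((`) ?g)"])
    show "\<forall>P\<in>?X A. (`) ?g ` (`) h ` P = P"
      using image_image_partition_id[of A _ ?g h] bij_betw_inv_into_left[OF h] by blast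
    show "\<forall>P\<in>?X {..<card A}. (`) h ` (`) ?g ` P = P"
      using image_image_partition_id[of "{..<card A}" _ h ?g] bij_betw_inv_into_right[OF h] by blast
    show "(`) ((`) h) ` ?X A \<subseteq> ?X {..<card A}"
      using transport[OF h] by (rule image_subsetI)
    show "(`) ((`) ?g) ` ?X {..<card A} \<subseteq> ?X A"
      using transport[OF g] by (rule image_subsetI)
  qed
  then show ?thesis
    unfolding assoc2_Stirling_def by (rule bij_betw_same_card)
qed

section \<open>Splitting off the singleton blocks\<close>

lemma singletons_image_Union_singleton_blocks:
  "(\<lambda>d. {d}) ` \<Union>(singleton_blocks P) = singleton_blocks P"
  by (force simp: singleton_blocks_def card_1_singleton_iff)

lemma card_Union_singleton_blocks:
  "card (\<Union>(singleton_blocks P)) = card (singleton_blocks P)"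
  using card_image[of "\<lambda>d. {d}" "\<Union>(singleton_blocks P)"]
  by (simp add: singletons_image_Union_singleton_blocks)

text \<open>The inverse collects the elements of the singleton blocks into \<open>S\<close> and
  keeps the other blocks. The hypothesis \<open>le\<close> makes the block counts add up, as
  \<open>\<nu> + (\<mu> - \<nu>) = \<mu>\<close> under truncated subtraction.\<close>

lemma bij_betw_adjoin_singletons:
  assumes A: "finite A" and le: "\<nu> \<le> \<mu>"
  shows "bij_betw (\<lambda>(S, P). (\<lambda>d. {d}) ` S \<union> P)
    (SIGMA S:{S. S \<subseteq> A \<and> card S = \<nu>}.
       {P. partition_on (A - S) P \<and> card P = \<mu> - \<nu> \<and> (\<forall>B\<in>P. card B \<ge> 2)})
    {P. partition_on A P \<and> card P = \<mu> \<and> card (singleton_blocks P) = \<nu>}"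
    (is "bij_betw ?f ?X ?Y")
proof (rule bij_betw_byWitness[where
    f' = "\<lambda>P. (\<Union>(singleton_blocks P), P - singleton_blocks P)"])
  \<comment> \<open>No block of \<open>P\<close> has size one, so the adjoined singletons can be
    recognised in the union.\<close>
  have sing: "singleton_blocks ((\<lambda>d. {d}) ` S \<union> P) = (\<lambda>d. {d}) ` S"
    and disj: "(\<lambda>d. {d}) ` S \<inter> P = {}" if "\<forall>B\<in>P. card B \<ge> 2" for S :: "'a set" and P
    using that by (auto simp: singleton_blocks_def)
  show "\<forall>x\<in>?X. (\<Union>(singleton_blocks (?f x)), ?f x - singleton_blocks (?f x)) = x"
  proof
    fix x assume "x \<in> ?X"
    then obtain S P where x: "x = (S, P)" and P: "\<forall>B\<in>P. card B \<ge> 2" by auto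
    have "(\<lambda>d. {d}) ` S \<union> P - (\<lambda>d. {d}) ` S = P" using disj[OF P, of S] by blast
    then show "(\<Union>(singleton_blocks (?f x)), ?f x - singleton_blocks (?f x)) = x"
      by (simp add: x sing[OF P])
  qed
  show "\<forall>P\<in>?Y. ?f (\<Union>(singleton_blocks P), P - singleton_blocks P) = P"
  proof
    fix P :: "'a set set"
    have "singleton_blocks P \<subseteq> P" by (auto simp: singleton_blocks_def)
    then show "?f (\<Union>(singleton_blocks P), P - singleton_blocks P) = P"
      by (simp add: singletons_image_Union_singleton_blocks Un_absorb1)
  qed
  show "?f ` ?X \<subseteq> ?Y"
  proof (rule image_subsetI)
    fix x assume "x \<in> ?X"
    then obtain S P where x: "x = (S, P)" and S: "S \<subseteq> A" "card S = \<nu>"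
      and P: "partition_on (A - S) P" "card P = \<mu> - \<nu>" "\<forall>B\<in>P. card B \<ge> 2"
      by auto
    have fin: "finite S" "finite P"
      using S A P(1) by (auto intro: finite_subset finite_elements[OF _ P(1)])
    have c: "card ((\<lambda>d. {d}) ` S) = \<nu>"
      using S by (simp add: card_image)
    have "partition_on A ((\<lambda>d. {d}) ` S \<union> P)"
    proof (rule partition_onI)
      show "\<Union>((\<lambda>d. {d}) ` S \<union> P) = A"
        using S(1) P(1) by (auto simp: partition_on_def)
    \<comment> \<open>The blocks of \<open>P\<close> lie in \<open>A - S\<close>, so none of them
      meets an adjoined singleton.\<close>
    qed (use P(1) in \<open>auto simp: partition_on_def disjoint_def disjnt_def\<close>)
    moreover have "card ((\<lambda>d. {d}) ` S \<union> P) = \<mu>"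
      using fin disj[OF P(3)] c P(2) le by (simp add: card_Un_disjoint)
    ultimately show "?f x \<in> ?Y"
      using x sing[OF P(3)] c by simp
  qed
  show "(\<lambda>P. (\<Union>(singleton_blocks P), P - singleton_blocks P)) ` ?Y \<subseteq> ?X"
  proof (rule image_subsetI)
    fix P assume "P \<in> ?Y"
    then have P: "partition_on A P" "card P = \<mu>" "card (singleton_blocks P) = \<nu>" by auto
    have fin: "finite P" using finite_elements[OF A P(1)] .
    have sub: "singleton_blocks P \<subseteq> P" by (auto simp: singleton_blocks_def)
    have "\<Union>(singleton_blocks P) \<subseteq> A"
      using P(1) sub by (auto simp: partition_on_def)
    moreover have "partition_on (A - \<Union>(singleton_blocks P)) (P - singleton_blocks P)"
    proof (rule partition_onI)
      \<comment> \<open>Disjointness of the blocks ensures that removing some of them removes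
        exactly their elements.\<close>
      show "\<Union>(P - singleton_blocks P) = A - \<Union>(singleton_blocks P)"
        using diff_Union_pairwise_disjoint[OF _ sub] partition_onD1[OF P(1)] partition_onD2[OF P(1)]
        by simp
    qed (use P(1) in \<open>auto simp: partition_on_def disjoint_def disjnt_def\<close>)
    moreover have "card (P - singleton_blocks P) = \<mu> - \<nu>"
      using P card_Diff_subset[OF finite_subset[OF sub fin] sub] by simp
    moreover have "card B \<ge> 2" if "B \<in> P - singleton_blocks P" for B
    proof -
      \<comment> \<open>Finiteness matters as well as nonemptiness: an infinite block would have
        \<open>card\<close> 0.\<close>
      have "finite B" "B \<noteq> {}"
        using that P(1) A by (auto simp: partition_on_def intro: finite_subset)
      then have "card B \<noteq> 0" by simp
      moreover have "card B \<noteq> 1" using that by (auto simp: singleton_blocks_def)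
      ultimately show ?thesis by linarith
    qed
    ultimately show "(\<Union>(singleton_blocks P), P - singleton_blocks P) \<in> ?X"
      using P(3) card_Union_singleton_blocks by auto
  qed
qed

text \<open>Every choice of \<open>S\<close> leaves \<open>card A - \<nu>\<close> elements, so all
  summands over \<open>S\<close> are equal and the sum becomes a product.\<close>

lemma card_partitions_with_singletons:
  assumes A: "finite A" and le: "\<nu> \<le> \<mu>"
  shows "card {P. partition_on A P \<and> card P = \<mu> \<and> card (singleton_blocks P) = \<nu>}
    = (card A choose \<nu>) * assoc2_Stirling (card A - \<nu>) (\<mu> - \<nu>)"
proof -
  let ?\<S> = "{S. S \<subseteq> A \<and> card S = \<nu>}"
  let ?\<P> = "\<lambda>S. {P. partition_on (A - S) P \<and> card P = \<mu> - \<nu> \<and> (\<forall>B\<in>P. card B \<ge> 2)}"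
  have "card (?\<P> S) = assoc2_Stirling (card A - \<nu>) (\<mu> - \<nu>)" if "S \<in> ?\<S>" for S
    using that A card_partitions_blocks_ge_2[of "A - S"]
    by (auto simp: card_Diff_subset finite_subset)
  moreover have "card (Sigma ?\<S> ?\<P>) = (\<Sum>S\<in>?\<S>. card (?\<P> S))"
    using A by (intro card_SigmaI) (auto intro: finite_partitions)
  ultimately show ?thesis
    using bij_betw_same_card[OF bij_betw_adjoin_singletons[OF A le]] n_subsets[OF A] by simp
qed

section \<open>Occupied and singleton pegs of a Hanoi state\<close>

lemma occupied_pegs_eq_image:
  assumes "s \<in> hanoi_states p n"
  shows "occupied_pegs p n s = s ` {..<n}"
  using assms
  by (auto simp: occupied_pegs_def discs_on_def hanoi_states_def Suc_le_eq card_gt_0_iff)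

text \<open>A peg with exactly one disc is occupied, so the search may be restricted to the image of
  \<open>s\<close>.\<close>

lemma singleton_pegs_eq:
  assumes "s \<in> hanoi_states p n"
  shows "singleton_pegs p n s = {i \<in> s ` {..<n}. card {d \<in> {..<n}. s d = i} = 1}"
proof -
  have "singleton_pegs p n s = {i \<in> occupied_pegs p n s. card (discs_on n s i) = 1}"
    by (auto simp: singleton_pegs_def occupied_pegs_def)
  then show ?thesis
    using occupied_pegs_eq_image[OF assms] by (simp add: discs_on_def)
qed

theorem mainTheorem2:
  fixes p n r \<nu> \<mu> :: nat
  assumes "p \<ge> 3" and "n \<ge> 0" and "r = min n p"
    and "1 \<le> \<nu>" and "\<nu> \<le> \<mu>" and "\<mu> \<le> r"
  shows "hanoi_O p n \<nu> \<mu> =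
    (n choose \<nu>) * assoc2_Stirling (n - \<nu>) (\<mu> - \<nu>) * falling_factorial p \<mu>"
proof -
  let ?Q = "\<lambda>P. card P = \<mu> \<and> card (singleton_blocks P) = \<nu>"
  \<comment> \<open>Both peg counts depend on the state only through its fibre partition: occupied
    pegs index the blocks, and singleton pegs the blocks of size one.\<close>
  have "{s \<in> hanoi_states p n. card (occupied_pegs p n s) = \<mu> \<and> card (singleton_pegs p n s) = \<nu>}
      = {s \<in> hanoi_states p n. ?Q (fibre_partition {..<n} s)}"
    by (rule Collect_cong)
      (auto simp: occupied_pegs_eq_image singleton_pegs_eq card_fibre_partition
        card_singleton_blocks_fibre_partition)
  then have "hanoi_O p n \<nu> \<mu> = card {P. partition_on {..<n} P \<and> ?Q P} * falling_factorial p \<mu>"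
    unfolding hanoi_O_def
    using card_states_by_partition[of "{..<n}" ?Q \<mu> p] by (simp add: hanoi_states_def)
  then show ?thesis
    using card_partitions_with_singletons[of "{..<n}" \<nu> \<mu>] assms by simp
qed

end
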